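(* Let $\varepsilon>0$, let $m\ge 1$ be an integer, and let $U$ be a unitary operator with eigenvector $|\psi\rangle$ and eigenvalue $e^{2\pi i\phi}$, $\phi\in[0,1)$. In the iterative phase estimation algorithm with per-bit repetitions and majority voting (defined in the context), repeating the iterations for the $O(\log(1/\varepsilon))$ least significant bits an $O(\log(1/\varepsilon))$ number of times gives an error probability smaller than $\varepsilon$, independently of $m$; here an error means that the $m$-bit output is not an estimate of $\phi$ accurate to at least $m$ binary digits. The total number of iterations (measurements) is then $O(m+\log^2(1/\varepsilon))$, and the controlled-$U$ gate is used $$\sum_{k=1}^m 2^{k-1}+\lceil\log(1/\varepsilon)\rceil\sum_{t=1}^{\lceil\log(1/\varepsilon)\rceil}2^{m-t}=O\bigl(2^m\log(1/\varepsilon)\bigr)$$ times.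
   Context: Binary notation: $0.b_1b_2\ldots b_r=\sum_{j=1}^r b_j2^{-j}$. Iterative phase estimation algorithm: bits $x_m,x_{m-1},\ldots,x_1$ are determined in this order (least significant first), and the output estimate is $\hat\phi=0.x_1x_2\ldots x_m$. Set $\omega_m=0$ and, for $k<m$, $\omega_k=-2\pi(0.0x_{k+1}x_{k+2}\ldots x_m)$, using the already determined bits. One iteration (trial) for bit $k$: prepare a single ancilla qubit in $|0\rangle$ with the second register in $|\psi\rangle$; apply the Hadamard gate $H$ to the ancilla, then controlled-$U^{2^{k-1}}$ with the ancilla as control (implemented by $2^{k-1}$ uses of the controlled-$U$ gate), then the $z$-rotation $R_z(\omega_k)=\mathrm{diag}(e^{-i\omega_k/2},e^{i\omega_k/2})$ and $H$ to the ancilla, and measure the ancilla in the basis $\{|0\rangle,|1\rangle\}$. Repetitions and majority voting: the iteration for a repeated bit $k$ is performed as several independent trials with the same $\omega_k$, and $x_k$ is chosen by majority voting from the results. Bits that are not repeated are determined by a single measurement. Accuracy: write $\phi=\tilde\phi+\delta 2^{-m}$, where $\tilde\phi$ consists of the first $m$ bits of the binary expansion of $\phi$ and $0\le\delta<1$. An estimate $\hat\phi$ is accurate to at least $m$ binary digits if its error is smaller than $2^{-m}$, i.e. $|\phi-\hat\phi|<2^{-m}$ (the candidates being $\tilde\phi$, rounding down, and $\tilde\phi+2^{-m}$, rounding up).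
   Formalization: Accuracy is measured modulo 1 (output 0 counts as rounding up to 1; literally the claim fails for φ just below 1), and the gate formula is exact when the number of repeated bits is at most m, otherwise an upper bound (equality then fails). *)

theory Defs
  imports
    "HOL-Probability.Probability_Mass_Function"
    "Jordan_Normal_Form.Schur_Decomposition"
    "Jordan_Normal_Form.Char_Poly"
begin

no_notation vec_nth (infixl "$" 90)

definition unitary_mat :: "complex mat \<Rightarrow> bool" where
  "unitary_mat U \<longleftrightarrow>
     square_mat U \<and> mat_adjoint U * U = 1\<^sub>m (dim_row U) \<and> U * mat_adjoint U = 1\<^sub>m (dim_row U)"

definition binary_fraction :: "bool list \<Rightarrow> real" where
  "binary_fraction xs = (\<Sum>j=1..length xs. of_bool (xs ! (j - 1)) / 2 ^ j)"

(* The ancilla is the first tensor factor: for a second register of dimension d, the coordinates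
   i < d of a joint state belong to ancilla |0>, the coordinates d + i to ancilla |1>.
   In particular on_ancilla d A is the Kronecker product of the 2x2 matrix A with 1\<^sub>m d. *)

definition on_ancilla :: "nat \<Rightarrow> complex mat \<Rightarrow> complex mat" where
  "on_ancilla d A = four_block_mat
     (A $$ (0, 0) \<cdot>\<^sub>m 1\<^sub>m d) (A $$ (0, 1) \<cdot>\<^sub>m 1\<^sub>m d)
     (A $$ (1, 0) \<cdot>\<^sub>m 1\<^sub>m d) (A $$ (1, 1) \<cdot>\<^sub>m 1\<^sub>m d)"

definition controlled :: "complex mat \<Rightarrow> complex mat" where
  "controlled U = (let d = dim_row U in four_block_mat (1\<^sub>m d) (0\<^sub>m d d) (0\<^sub>m d d) U)"

definition hadamard :: "complex mat" where
  "hadamard = complex_of_real (1 / sqrt 2) \<cdot>\<^sub>m mat_of_rows_list 2 [[1, 1], [1, -1]]"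

definition R_z :: "real \<Rightarrow> complex mat" where
  "R_z \<omega> = mat_of_rows_list 2
     [[exp (- \<i> * complex_of_real (\<omega> / 2)), 0],
      [0, exp (\<i> * complex_of_real (\<omega> / 2))]]"

definition trial_state :: "complex mat \<Rightarrow> complex vec \<Rightarrow> nat \<Rightarrow> real \<Rightarrow> complex vec" where
  "trial_state U \<psi> k \<omega> = (let d = dim_row U in
     on_ancilla d hadamard *\<^sub>v (on_ancilla d (R_z \<omega>) *\<^sub>v
       ((controlled U ^\<^sub>m 2 ^ (k - 1)) *\<^sub>v
         (on_ancilla d hadamard *\<^sub>v (\<psi> @\<^sub>v 0\<^sub>v d)))))"

(* Born rule for the ancilla; True is the outcome 1. *)
definition prob_one :: "nat \<Rightarrow> complex vec \<Rightarrow> real" where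
  "prob_one d s = (\<Sum>i<d. (cmod (vec_index s (d + i)))\<^sup>2)"

definition trial_pmf :: "complex mat \<Rightarrow> complex vec \<Rightarrow> nat \<Rightarrow> real \<Rightarrow> bool pmf" where
  "trial_pmf U \<psi> k \<omega> = bernoulli_pmf (prob_one (dim_row U) (trial_state U \<psi> k \<omega>))"

(* tie is the value chosen when an even number of trials splits equally. *)
definition majority :: "bool \<Rightarrow> bool list \<Rightarrow> bool" where
  "majority tie ys =
     (if count_list ys True > count_list ys False then True
      else if count_list ys True < count_list ys False then False
      else tie)"

definition vote_pmf :: "bool \<Rightarrow> nat \<Rightarrow> bool pmf \<Rightarrow> bool pmf" where
  "vote_pmf tie n p = map_pmf (majority tie) (replicate_pmf n p)"

(* xs = [x_{k+1}, ..., x_m]; the prepended False is the digit 0 in 0.0x_{k+1}...x_m.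
   For k = m this gives the angle 0. *)
definition feedback_angle :: "bool list \<Rightarrow> real" where
  "feedback_angle xs = - 2 * pi * binary_fraction (False # xs)"

(* Joint distribution of the j least significant bits [x_{m-j+1}, ..., x_m], where bit k is
   decided by a vote over r k trials; the whole output is the case j = m. *)
primrec ipea_bits ::
  "bool \<Rightarrow> (nat \<Rightarrow> nat) \<Rightarrow> complex mat \<Rightarrow> complex vec \<Rightarrow> nat \<Rightarrow> nat \<Rightarrow> bool list pmf" where
  "ipea_bits tie r U \<psi> m 0 = return_pmf []"
| "ipea_bits tie r U \<psi> m (Suc j) =
     bind_pmf (ipea_bits tie r U \<psi> m j) (\<lambda>xs.
       map_pmf (\<lambda>x. x # xs)
         (vote_pmf tie (r (m - j)) (trial_pmf U \<psi> (m - j) (feedback_angle xs))))"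

definition ipea ::
  "bool \<Rightarrow> (nat \<Rightarrow> nat) \<Rightarrow> complex mat \<Rightarrow> complex vec \<Rightarrow> nat \<Rightarrow> bool list pmf" where
  "ipea tie r U \<psi> m = ipea_bits tie r U \<psi> m m"

(* The L least significant bits get N further trials in addition to the first one. *)
definition trials :: "nat \<Rightarrow> nat \<Rightarrow> nat \<Rightarrow> nat \<Rightarrow> nat" where
  "trials m L N k = (if m < k + L then 1 + N else 1)"

definition iteration_count :: "nat \<Rightarrow> (nat \<Rightarrow> nat) \<Rightarrow> nat" where
  "iteration_count m r = (\<Sum>k=1..m. r k)"

definition gate_count :: "nat \<Rightarrow> (nat \<Rightarrow> nat) \<Rightarrow> nat" where
  "gate_count m r = (\<Sum>k=1..m. r k * 2 ^ (k - 1))"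

(* Phases are defined modulo 1: the rounded-up candidate is 1 when the first m bits of phi are all 1,
   and it is then output as 0.00...0. *)
definition accurate :: "nat \<Rightarrow> real \<Rightarrow> real \<Rightarrow> bool" where
  "accurate m \<phi> \<phi>' \<longleftrightarrow> (\<exists>z::int. \<bar>\<phi> - \<phi>' - of_int z\<bar> < 1 / 2 ^ m)"

(* The base b of the logarithm carries the constant factor hidden in O(log (1 / eps)).
   For eps \<ge> 1 the value is 0. *)
definition log_reps :: "real \<Rightarrow> real \<Rightarrow> nat" where
  "log_reps b \<epsilon> = nat \<lceil>log b (1 / \<epsilon>)\<rceil>"

(* The exponent m - t is negative when more than m bits are requested, hence the integer power. *)
definition gate_formula :: "real \<Rightarrow> real \<Rightarrow> nat \<Rightarrow> real" where
  "gate_formula b \<epsilon> m =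
     (\<Sum>k=1..m. 2 ^ (k - 1)) +
     real (log_reps b \<epsilon>) * (\<Sum>t=1..log_reps b \<epsilon>. 2 powi (int m - int t))"

end

(* Call an integer T with |2^m phi - T| <= 2/3 a target. If the bits found so far are the last j
   binary digits of a target T, a single trial gets the next digit of T wrong with probability
   sin^2(pi (2^m phi - T) / 2^(j+1)), which is at most 1/4 and at most 2^-(j+1), except possibly
   for j = 0; in the exceptional case 2^m phi lies between 1/3 and 2/3 of the way from one integer
   to the next, and both outcomes of the first measurement agree with a target.
   With L the number of repeated bits, a majority vote over L + 1 trials errs with probability
   at most s = (7/8)^(L+1), while the errors of the unrepeated bits sum up to less than 2^-L. Hence the
   algorithm succeeds with probability above (1 - s)^L (1 - 2^-L), uniformly in m. The complement of this
   bound decays exponentially in L and is below 1 for every L > 0, so it is at most b^-L for every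
   base b close enough to 1, and b^-L <= eps for L = ceil(log_b(1/eps)). *)

theory Submission
  imports Defs
begin

section \<open>Measures of composed distributions\<close>

lemma measure_bind_pmf:
  "measure (measure_pmf (bind_pmf p f)) A = (\<integral>x. measure (measure_pmf (f x)) A \<partial>measure_pmf p)"
  unfolding measure_pmf_bind
  by (rule measure_pmf.measure_bind[where N = "count_space UNIV"])
     (auto simp: space_subprob_algebra intro: prob_space_imp_subprob_space measure_pmf.prob_space_axioms)

text \<open>The outcome \<open>c\<close> is left free because the correct value of a bit may be
  either one.\<close>

lemma measure_bind_bool_pmf:
  fixes p :: "bool pmf"
  shows "measure (measure_pmf (bind_pmf p f)) A =
    pmf p c * measure (measure_pmf (f c)) A + pmf p (\<not> c) * measure (measure_pmf (f (\<not> c))) A"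
  unfolding measure_bind_pmf
  by (subst integral_measure_pmf_real[of UNIV]) (cases c; auto simp: UNIV_bool)+

text \<open>Outside \<open>G\<close> the second stage is bounded below by 0. Successive bits are not
  independent, but a lower bound conditional on the earlier bits being good still lets the success
  probabilities multiply.\<close>

lemma measure_bind_pmf_ge:
  assumes "\<And>x. x \<in> G \<Longrightarrow> e \<le> measure (measure_pmf (f x)) A"
  shows "measure (measure_pmf p) G * e \<le> measure (measure_pmf (bind_pmf p f)) A"
proof -
  have "measure (measure_pmf p) G * e = (\<integral>x. e * indicator G x \<partial>measure_pmf p)"
    by simp
  also have "\<dots> \<le> (\<integral>x. measure (measure_pmf (f x)) A \<partial>measure_pmf p)"
    by (intro integral_mono measure_pmf.integrable_const_bound[where B = 1]
          integrable_mult_right integrable_real_indicator)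
       (auto simp: assms indicator_def less_top[symmetric] intro: order_trans)
  finally show ?thesis by (simp add: measure_bind_pmf)
qed

section \<open>Majority votes\<close>

text \<open>Chernoff's bound in inductive form: every wrong vote costs a factor 2, every right one
  gains it back, and at error probability 1/4 the expected factor per trial is
  \<open>2 * 1/4 + 1/2 * 3/4 = 7/8\<close>.\<close>

lemma replicate_pmf_minority_le:
  fixes p :: "bool pmf" and a :: int
  assumes "pmf p (\<not> c) \<le> 1 / 4"
  shows "measure (measure_pmf (replicate_pmf n p))
     {ys. int (count_list ys c) \<le> int (count_list ys (\<not> c)) + a} \<le> (7 / 8) ^ n * 2 powi a"
proof (induction n arbitrary: a)
  case 0
  have "1 \<le> (2::real) powi a" if "0 \<le> a"
    using that by (simp add: power_int_def)
  then show ?case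
    by (auto simp: indicator_def)
next
  case (Suc n)
  define S where "S a = {ys. int (count_list ys c) \<le> int (count_list ys (\<not> c)) + a}" for a
  define P where "P a = measure (measure_pmf (replicate_pmf n p)) (S a)" for a
  \<comment> \<open>Removing the first vote shifts the offset by one in either direction, which is
    why the induction keeps \<open>a\<close> arbitrary.\<close>
  have eq: "(\<lambda>ys. c # ys) -` S a = S (a - 1)" "(\<lambda>ys. (\<not> c) # ys) -` S a = S (a + 1)"
    by (auto simp: S_def)
  have pc: "pmf p c = 1 - pmf p (\<not> c)"
    by (cases c) (simp_all add: pmf_False_conv_True)
  have "measure (measure_pmf (replicate_pmf (Suc n) p)) (S a)
      = pmf p c * P (a - 1) + pmf p (\<not> c) * P (a + 1)"
    unfolding replicate_pmf.simps measure_bind_bool_pmf[where c = c] map_pmf_def[symmetric]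
    by (simp add: eq P_def)
  also have "\<dots> \<le> pmf p c * ((7 / 8) ^ n * 2 powi (a - 1)) + pmf p (\<not> c) * ((7 / 8) ^ n * 2 powi (a + 1))"
    using Suc.IH by (intro add_mono mult_left_mono) (auto simp: P_def S_def)
  also have "\<dots> = (7 / 8) ^ n * 2 powi a * (1 / 2 + 3 / 2 * pmf p (\<not> c))"
    by (simp add: pc power_int_diff power_int_add field_simps)
  also have "\<dots> \<le> (7 / 8) ^ n * 2 powi a * (7 / 8)"
    using assms by (intro mult_left_mono) auto
  finally show ?case by (simp add: S_def)
qed

lemma vote_pmf_error_le:
  assumes "pmf p (\<not> c) \<le> 1 / 4"
  shows "pmf (vote_pmf tie n p) (\<not> c) \<le> (7 / 8) ^ n"
proof -
  have "pmf (vote_pmf tie n p) (\<not> c)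
      = measure (measure_pmf (replicate_pmf n p)) (majority tie -` {\<not> c})"
    by (simp add: vote_pmf_def pmf_map)
  \<comment> \<open>The offset 0 counts a draw as an error, so the bound holds for both values of
    \<open>tie\<close>.\<close>
  also have "\<dots> \<le> measure (measure_pmf (replicate_pmf n p))
     {ys. int (count_list ys c) \<le> int (count_list ys (\<not> c)) + 0}"
    by (intro measure_pmf.finite_measure_mono) (auto simp: majority_def split: if_splits)
  also have "\<dots> \<le> (7 / 8) ^ n"
    using replicate_pmf_minority_le[OF assms, of n 0] by simp
  finally show ?thesis .
qed

lemma vote_pmf_1: "vote_pmf tie 1 p = p"
proof -
  have "vote_pmf tie 1 p = map_pmf (\<lambda>x. x) p"
    unfolding vote_pmf_def replicate_pmf_1 pmf.map_comp
    by (intro map_pmf_cong) (auto simp: majority_def)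
  then show ?thesis by simp
qed

section \<open>The circuit on an eigenvector and the outcome probability\<close>

text \<open>The joint state stays a product with \<open>u\<close>, stored as a pair of coefficients
  of \<open>u\<close>; an ancilla gate then acts as its 2x2 matrix on the pair.\<close>

lemma on_ancilla_mult_append:
  assumes u: "u \<in> carrier_vec d"
  shows "on_ancilla d A *\<^sub>v ((x \<cdot>\<^sub>v u) @\<^sub>v (y \<cdot>\<^sub>v u)) =
    ((A $$ (0, 0) * x + A $$ (0, 1) * y) \<cdot>\<^sub>v u) @\<^sub>v ((A $$ (1, 0) * x + A $$ (1, 1) * y) \<cdot>\<^sub>v u)"
proof -
  have "(a \<cdot>\<^sub>m 1\<^sub>m d) *\<^sub>v (x \<cdot>\<^sub>v u) = (a * x) \<cdot>\<^sub>v u" for a x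
  proof -
    have "(a \<cdot>\<^sub>m 1\<^sub>m d) *\<^sub>v (x \<cdot>\<^sub>v u) = a \<cdot>\<^sub>v (1\<^sub>m d *\<^sub>v (x \<cdot>\<^sub>v u))"
      using u by (intro eq_vecI) auto
    then show ?thesis
      using u by (simp add: smult_smult_assoc)
  qed
  then show ?thesis
    unfolding on_ancilla_def using u
    by (subst four_block_mat_mult_vec[of _ d d _ d _ d]) (auto simp: add_smult_distrib_vec)
qed

text \<open>Phase kickback: only the ancilla-1 branch picks up the eigenvalue. Matrix powers peel
  off the factor that acts first, so \<open>y\<close> must vary in the induction.\<close>

lemma controlled_power_mult_append:
  assumes U: "U \<in> carrier_mat d d" and ev: "eigenvector U u \<mu>"
  shows "(controlled U ^\<^sub>m n) *\<^sub>v ((x \<cdot>\<^sub>v u) @\<^sub>v (y \<cdot>\<^sub>v u)) = (x \<cdot>\<^sub>v u) @\<^sub>v ((\<mu> ^ n * y) \<cdot>\<^sub>v u)"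
proof (induction n arbitrary: y)
  case 0
  have "controlled U \<in> carrier_mat (d + d) (d + d)"
    using U by (auto simp: controlled_def Let_def)
  moreover have "(x \<cdot>\<^sub>v u) @\<^sub>v (y \<cdot>\<^sub>v u) \<in> carrier_vec (d + d)"
    using U ev by (auto simp: eigenvector_def)
  ultimately show ?case by auto
next
  case (Suc n)
  have C: "controlled U \<in> carrier_mat (d + d) (d + d)"
    using U by (auto simp: controlled_def Let_def)
  have u: "u \<in> carrier_vec d" and Uu: "U *\<^sub>v u = \<mu> \<cdot>\<^sub>v u"
    using U ev by (auto simp: eigenvector_def)
  have "controlled U *\<^sub>v ((x \<cdot>\<^sub>v u) @\<^sub>v (y \<cdot>\<^sub>v u)) = (x \<cdot>\<^sub>v u) @\<^sub>v ((\<mu> * y) \<cdot>\<^sub>v u)"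
  proof -
    have "U *\<^sub>v (y \<cdot>\<^sub>v u) = (\<mu> * y) \<cdot>\<^sub>v u"
      using U u by (simp add: mult_mat_vec Uu smult_smult_assoc mult.commute)
    then show ?thesis
      unfolding controlled_def Let_def using U u
      by (subst four_block_mat_mult_vec[of _ d d _ d _ d]) auto
  qed
  moreover have "(controlled U ^\<^sub>m Suc n) *\<^sub>v ((x \<cdot>\<^sub>v u) @\<^sub>v (y \<cdot>\<^sub>v u))
      = (controlled U ^\<^sub>m n) *\<^sub>v (controlled U *\<^sub>v ((x \<cdot>\<^sub>v u) @\<^sub>v (y \<cdot>\<^sub>v u)))"
    using C u by (auto intro!: assoc_mult_mat_vec)
  ultimately show ?case
    using Suc.IH[of "\<mu> * y"] by (simp add: ac_simps)
qed

lemma hadamard_index: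
  "hadamard $$ (0, 0) = 1 / sqrt 2" "hadamard $$ (0, 1) = 1 / sqrt 2"
  "hadamard $$ (1, 0) = 1 / sqrt 2" "hadamard $$ (1, 1) = - 1 / sqrt 2"
  by (simp_all add: hadamard_def mat_of_rows_list_def)

lemma R_z_index:
  "R_z \<omega> $$ (0, 0) = cis (- \<omega> / 2)" "R_z \<omega> $$ (0, 1) = 0"
  "R_z \<omega> $$ (1, 0) = 0" "R_z \<omega> $$ (1, 1) = cis (\<omega> / 2)"
  by (simp_all add: R_z_def mat_of_rows_list_def cis_conv_exp)

text \<open>The amplitude of outcome 1 is half such a difference; its size depends only on the
  relative phase x + y of the two interfering branches.\<close>

lemma cmod_cis_minus_cis_square: "(cmod (cis (- x) - cis y))\<^sup>2 = 4 * (sin ((x + y) / 2))\<^sup>2"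
proof -
  have "(cmod (cis (- x) - cis y))\<^sup>2 = (cos x - cos y)\<^sup>2 + (sin x + sin y)\<^sup>2"
    unfolding cmod_power2 by (simp add: algebra_simps power2_eq_square)
  also have "\<dots> = ((sin x)\<^sup>2 + (cos x)\<^sup>2) + ((sin y)\<^sup>2 + (cos y)\<^sup>2) - 2 * cos (x + y)"
  proof -
    have "(a - b)\<^sup>2 + (c + d)\<^sup>2 = (c\<^sup>2 + a\<^sup>2) + (d\<^sup>2 + b\<^sup>2) - 2 * (a * b - c * d)" for a b c d :: real
      by (simp add: power2_eq_square algebra_simps)
    then show ?thesis unfolding cos_add .
  qed
  also have "\<dots> = 2 - 2 * cos (x + y)"
    by simp
  also have "\<dots> = 4 * (sin ((x + y) / 2))\<^sup>2"
  proof -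
    have "x + y = 2 * ((x + y) / 2)" by simp
    then have "cos (x + y) = 1 - 2 * (sin ((x + y) / 2))\<^sup>2"
      by (metis cos_double_sin)
    then show ?thesis by simp
  qed
  finally show ?thesis .
qed

text \<open>The coefficient of the ancilla-0 branch stays existential, since the probability of
  outcome 1 reads only the other half of the vector.\<close>

lemma trial_state_eigenvector:
  assumes U: "U \<in> carrier_mat d d"
    and ev: "eigenvector U \<psi> (exp (2 * complex_of_real pi * \<i> * complex_of_real \<phi>))"
  shows "\<exists>x. trial_state U \<psi> k \<omega> = (x \<cdot>\<^sub>v \<psi>) @\<^sub>v
    ((1 / 2 * (cis (- \<omega> / 2) - cis (\<omega> / 2 + 2 * pi * 2 ^ (k - 1) * \<phi>))) \<cdot>\<^sub>v \<psi>)"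
proof -
  let ?h = "complex_of_real (1 / sqrt 2)" and ?\<mu> = "cis (2 * pi * \<phi>)"
  have \<psi>: "\<psi> \<in> carrier_vec d" and d: "dim_row U = d"
    using U ev by (auto simp: eigenvector_def)
  have ev': "eigenvector U \<psi> ?\<mu>"
    using ev by (simp add: cis_conv_exp mult_ac)
  have "\<psi> = 1 \<cdot>\<^sub>v \<psi>" "0\<^sub>v d = 0 \<cdot>\<^sub>v \<psi>"
    using \<psi> by auto
  then have "trial_state U \<psi> k \<omega> = on_ancilla d hadamard *\<^sub>v (on_ancilla d (R_z \<omega>) *\<^sub>v
       ((controlled U ^\<^sub>m 2 ^ (k - 1)) *\<^sub>v (on_ancilla d hadamard *\<^sub>v ((1 \<cdot>\<^sub>v \<psi>) @\<^sub>v (0 \<cdot>\<^sub>v \<psi>)))))"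
    by (simp add: trial_state_def d)
  also have "\<dots> = ((?h * (cis (- \<omega> / 2) * ?h) + ?h * (cis (\<omega> / 2) * (?\<mu> ^ 2 ^ (k - 1) * ?h))) \<cdot>\<^sub>v \<psi>) @\<^sub>v
      ((?h * (cis (- \<omega> / 2) * ?h) + (- ?h) * (cis (\<omega> / 2) * (?\<mu> ^ 2 ^ (k - 1) * ?h))) \<cdot>\<^sub>v \<psi>)"
    by (simp only: on_ancilla_mult_append[OF \<psi>] controlled_power_mult_append[OF U ev']
          hadamard_index R_z_index) simp
  also have "?h * (cis (- \<omega> / 2) * ?h) + (- ?h) * (cis (\<omega> / 2) * (?\<mu> ^ 2 ^ (k - 1) * ?h))
      = (?h * ?h) * (cis (- \<omega> / 2) - cis (\<omega> / 2) * ?\<mu> ^ 2 ^ (k - 1))"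
    by (simp add: algebra_simps)
  also have "?h * ?h = 1 / 2"
    unfolding of_real_mult[symmetric] by simp
  also have "cis (\<omega> / 2) * ?\<mu> ^ 2 ^ (k - 1) = cis (\<omega> / 2 + 2 * pi * 2 ^ (k - 1) * \<phi>)"
    by (simp add: Complex.DeMoivre cis_mult algebra_simps)
  finally show ?thesis by blast
qed

lemma pmf_trial_pmf_True:
  assumes U: "U \<in> carrier_mat d d"
    and ev: "eigenvector U \<psi> (exp (2 * complex_of_real pi * \<i> * complex_of_real \<phi>))"
    and norm: "\<psi> \<bullet>c \<psi> = 1"
  shows "pmf (trial_pmf U \<psi> k \<omega>) True = (sin (pi * 2 ^ (k - 1) * \<phi> + \<omega> / 2))\<^sup>2"
proof -
  have \<psi>: "\<psi> \<in> carrier_vec d" and d: "dim_row U = d"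
    using U ev by (auto simp: eigenvector_def)
  define y where "y = 1 / 2 * (cis (- \<omega> / 2) - cis (\<omega> / 2 + 2 * pi * 2 ^ (k - 1) * \<phi>))"
  obtain x where state: "trial_state U \<psi> k \<omega> = (x \<cdot>\<^sub>v \<psi>) @\<^sub>v (y \<cdot>\<^sub>v \<psi>)"
    using trial_state_eigenvector[OF U ev] unfolding y_def by blast
  have "complex_of_real (\<Sum>i<d. (cmod (vec_index \<psi> i))\<^sup>2) = \<psi> \<bullet>c \<psi>"
    using \<psi> unfolding of_real_sum complex_norm_square
    by (auto simp: scalar_prod_def lessThan_atLeast0 intro!: sum.cong)
  then have one: "(\<Sum>i<d. (cmod (vec_index \<psi> i))\<^sup>2) = 1"
    using norm by (metis of_real_eq_1_iff)
  have "prob_one d (trial_state U \<psi> k \<omega>) = (\<Sum>i<d. (cmod y)\<^sup>2 * (cmod (vec_index \<psi> i))\<^sup>2)"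
    unfolding prob_one_def state using \<psi>
    by (intro sum.cong) (auto simp: norm_mult power_mult_distrib)
  also have "\<dots> = (cmod y)\<^sup>2"
    by (simp add: sum_distrib_left[symmetric] one)
  also have "\<dots> = (sin (pi * 2 ^ (k - 1) * \<phi> + \<omega> / 2))\<^sup>2"
    using cmod_cis_minus_cis_square[of "\<omega> / 2" "\<omega> / 2 + 2 * pi * 2 ^ (k - 1) * \<phi>"]
    unfolding y_def norm_mult power_mult_distrib
    by (simp add: power_divide add_divide_distrib algebra_simps)
  finally have "prob_one d (trial_state U \<psi> k \<omega>) = (sin (pi * 2 ^ (k - 1) * \<phi> + \<omega> / 2))\<^sup>2" .
  \<comment> \<open>A squared sine lies in [0, 1], so the Bernoulli parameter is indeed the mass of
    \<open>True\<close>.\<close>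
  then show ?thesis
    by (simp add: trial_pmf_def d power_le_one abs_square_le_1)
qed


section \<open>Bounds on squared sines\<close>

lemma sin_square_le_quarter:
  assumes "\<bar>x\<bar> \<le> pi / 6"
  shows "(sin x)\<^sup>2 \<le> 1 / 4"
proof -
  have "\<bar>sin x\<bar> = sin \<bar>x\<bar>"
    using assms sin_ge_zero[of x] sin_ge_zero[of "- x"] by (auto simp: abs_if not_less)
  also have "\<dots> \<le> sin (pi / 6)"
    using assms by (intro sin_monotone_2pi_le) auto
  finally have "\<bar>sin x\<bar> \<le> 1 / 2"
    by (simp add: sin_30)
  then have "\<bar>sin x\<bar>\<^sup>2 \<le> (1 / 2)\<^sup>2"
    by (intro power_mono) auto
  then show ?thesis by (simp add: power2_eq_square)
qed

text \<open>Since sin^2(2y) = 4 sin^2(y) (1 - sin^2(y)), halving an angle at least halves the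
  squared sine while that is at most 1/2. This yields the geometric decay of the errors of later,
  more significant bits.\<close>

lemma sin_square_halving_le:
  assumes x: "\<bar>x\<bar> \<le> pi / 6"
  shows "(sin (x / 2 ^ n))\<^sup>2 \<le> (1 / 2) ^ (n + 2)"
proof (induction n)
  case 0
  then show ?case
    using sin_square_le_quarter[OF x] by (simp add: power2_eq_square)
next
  case (Suc n)
  define y where "y = x / 2 ^ Suc n"
  have "\<bar>y\<bar> = \<bar>x\<bar> / 2 ^ Suc n"
    by (simp add: y_def)
  also have "\<dots> \<le> \<bar>x\<bar> / 1"
    by (intro divide_left_mono one_le_power) auto
  finally have "(sin y)\<^sup>2 \<le> 1 / 4"
    using x by (intro sin_square_le_quarter) simp
  then have "(sin y)\<^sup>2 * 2 \<le> (sin y)\<^sup>2 * (4 * (1 - (sin y)\<^sup>2))"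
    by (intro mult_left_mono) auto
  also have "\<dots> = (sin (2 * y))\<^sup>2"
    unfolding sin_double power_mult_distrib cos_squared_eq by simp
  also have "2 * y = x / 2 ^ n"
    by (simp add: y_def)
  finally show ?case
    using Suc.IH by (simp add: y_def)
qed

section \<open>Targets, their digits, and the error of one vote\<close>

text \<open>\<open>T\<close> is the integer whose binary digits the bits \<open>xs\<close> reproduce, modulo \<open>2 ^ j\<close>. Every \<open>T\<close> within
  2/3 of \<open>2 ^ m * \<phi>\<close> is a legitimate target: if the last digit is ambiguous there are two of them.\<close>

definition tracks :: "nat \<Rightarrow> real \<Rightarrow> nat \<Rightarrow> bool list \<Rightarrow> bool" where
  "tracks m \<phi> j xs \<longleftrightarrow> length xs = j \<and>
     (\<exists>(T :: int) (z :: int). \<bar>2 ^ m * \<phi> - of_int T\<bar> \<le> 2 / 3 \<and> binary_fraction xs = of_int T / 2 ^ j - of_int z)"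

lemma binary_fraction_Cons:
  "binary_fraction (x # xs) = of_bool x / 2 + binary_fraction xs / 2"
proof -
  let ?f = "\<lambda>j. of_bool ((x # xs) ! (j - 1)) / (2::real) ^ j"
  have "binary_fraction (x # xs) = ?f 1 + (\<Sum>j = Suc 1..Suc (length xs). ?f j)"
    unfolding binary_fraction_def by (subst sum.atLeast_Suc_atMost) simp_all
  also have "(\<Sum>j = Suc 1..Suc (length xs). ?f j) = (\<Sum>j = 1..length xs. ?f (Suc j))"
    by (rule sum.shift_bounds_cl_Suc_ivl)
  also have "\<dots> = (\<Sum>j = 1..length xs. of_bool (xs ! (j - 1)) / 2 ^ j / 2)"
    by (intro sum.cong) (auto simp: nth_Cons split: nat.splits)
  also have "\<dots> = binary_fraction xs / 2"
    by (simp add: binary_fraction_def sum_divide_distrib)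
  finally show ?thesis by simp
qed

lemma binary_fraction_Nil: "binary_fraction [] = 0"
  by (simp add: binary_fraction_def)

text \<open>The tolerance 2/3 is below one unit of the last digit; \<open>z\<close> absorbs the
  wrap-around of phases modulo 1.\<close>

lemma tracks_accurate:
  assumes "tracks m \<phi> m xs"
  shows "accurate m \<phi> (binary_fraction xs)"
proof -
  obtain T z :: int where T: "\<bar>2 ^ m * \<phi> - T\<bar> \<le> 2 / 3"
    and xs: "binary_fraction xs = T / 2 ^ m - z"
    using assms by (auto simp: tracks_def)
  have "\<phi> - binary_fraction xs - z = (2 ^ m * \<phi> - T) / 2 ^ m"
    by (simp add: xs field_simps)
  then have "\<bar>\<phi> - binary_fraction xs - z\<bar> = \<bar>2 ^ m * \<phi> - T\<bar> / 2 ^ m"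
    by simp
  also have "\<dots> < 1 / 2 ^ m"
    using T by (intro divide_strict_right_mono) auto
  finally show ?thesis by (auto simp: accurate_def)
qed

text \<open>The integer \<open>z\<close> is \<open>T\<close> with its last \<open>j\<close> binary
  digits removed, so its parity is the next digit of \<open>T\<close>.\<close>

lemma tracks_Cons:
  assumes "length xs = j" "\<bar>2 ^ m * \<phi> - of_int T\<bar> \<le> 2 / 3"
    and "binary_fraction xs = of_int T / 2 ^ j - of_int z"
  shows "tracks m \<phi> (Suc j) (odd z # xs)"
proof -
  have "z = 2 * (z div 2) + of_bool (odd z)"
    by (simp add: mult.commute)
  then have "real_of_int z = 2 * of_int (z div 2) + of_bool (odd z)"
    by (metis of_int_add of_int_mult of_int_numeral of_int_of_bool)
  then have "binary_fraction (odd z # xs) = of_int T / 2 ^ Suc j - of_int (z div 2)"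
    by (simp add: binary_fraction_Cons assms(3) field_simps)
  then show ?thesis
    using assms by (auto simp: tracks_def)
qed

text \<open>A shift by pi changes only the sign of the sine, a shift by pi/2 exchanges sine and
  cosine up to sign.\<close>

lemma sin_square_add_half_pi_multiple:
  "(sin (y + pi * of_int z / 2))\<^sup>2 = (if odd z then (cos y)\<^sup>2 else (sin y)\<^sup>2)"
proof -
  have "sin (pi * of_int w) = 0" "(cos (pi * of_int w))\<^sup>2 = 1" for w :: int
    using sin_zero_iff_int2[of "pi * of_int w"] by (auto simp: cos_squared_eq)
  then have *: "(sin (x + pi * of_int w))\<^sup>2 = (sin x)\<^sup>2" for x and w :: int
    by (simp add: sin_add power_mult_distrib)
  show ?thesis
  proof (cases "odd z")
    case True
    then obtain w where "z = 2 * w + 1" by (rule oddE)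
    then have shift: "y + pi * of_int z / 2 = (y + pi / 2) + pi * of_int w"
      by (simp add: field_simps)
    show ?thesis unfolding shift * using True by (simp add: sin_add)
  next
    case False
    then obtain w where "z = 2 * w" by (auto elim: evenE)
    then show ?thesis using *[of y w] by simp
  qed
qed

text \<open>The feedback rotation cancels the digits of \<open>T\<close> found so far. What remains
  is the angle due to the distance from \<open>T\<close>, plus \<open>z\<close> quarter turns that
  encode the next digit.\<close>

lemma pmf_trial_pmf_wrong:
  assumes U: "U \<in> carrier_mat d d"
    and ev: "eigenvector U \<psi> (exp (2 * complex_of_real pi * \<i> * complex_of_real \<phi>))"
    and norm: "\<psi> \<bullet>c \<psi> = 1" and j: "j < m"
    and xs: "binary_fraction xs = of_int T / 2 ^ j - of_int z"
  shows "pmf (trial_pmf U \<psi> (m - j) (feedback_angle xs)) (\<not> odd z)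
    = (sin (pi * (2 ^ m * \<phi> - of_int T) / 2 ^ Suc j))\<^sup>2"
proof -
  have "(2::real) ^ m = 2 ^ (m - j - 1) * 2 ^ Suc j"
    unfolding power_add[symmetric] using j by simp
  then have "pi * 2 ^ (m - j - 1) * \<phi> + feedback_angle xs / 2
      = pi * (2 ^ m * \<phi> - of_int T) / 2 ^ Suc j + pi * of_int z / 2"
    by (simp add: feedback_angle_def binary_fraction_Cons xs field_simps)
  then have "pmf (trial_pmf U \<psi> (m - j) (feedback_angle xs)) True =
      (if odd z then (cos (pi * (2 ^ m * \<phi> - of_int T) / 2 ^ Suc j))\<^sup>2
       else (sin (pi * (2 ^ m * \<phi> - of_int T) / 2 ^ Suc j))\<^sup>2)"
    unfolding pmf_trial_pmf_True[OF U ev norm] by (simp add: sin_square_add_half_pi_multiple)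
  then show ?thesis
    by (cases "odd z") (simp_all add: pmf_False_conv_True sin_squared_eq)
qed


text \<open>The first digit is the only one whose single-trial error may exceed 1/4; then both
  outcomes have a target.\<close>

lemma vote_step:
  assumes U: "U \<in> carrier_mat d d"
    and ev: "eigenvector U \<psi> (exp (2 * complex_of_real pi * \<i> * complex_of_real \<phi>))"
    and norm: "\<psi> \<bullet>c \<psi> = 1" and j: "j < m" and xs: "tracks m \<phi> j xs"
  shows "1 - (if j < L then (7 / 8) ^ (L + 1) else (1 / 2) ^ (j + 1)) \<le>
    measure (measure_pmf (map_pmf (\<lambda>x. x # xs)
      (vote_pmf tie (trials m L L (m - j)) (trial_pmf U \<psi> (m - j) (feedback_angle xs)))))
      {ys. tracks m \<phi> (Suc j) ys}"
    (is "1 - ?e \<le> measure (measure_pmf (map_pmf _ ?q)) _")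
proof -
  let ?p = "trial_pmf U \<psi> (m - j) (feedback_angle xs)"
  have len: "length xs = j"
    using xs by (simp add: tracks_def)
  \<comment> \<open>The argument for one fixed target; \<open>close\<close> keeps the single-trial
    error at most 1/4.\<close>
  have single: ?thesis
    if T: "\<bar>2 ^ m * \<phi> - of_int T\<bar> \<le> 2 / 3" and z: "binary_fraction xs = of_int T / 2 ^ j - of_int z"
      and close: "0 < j \<or> \<bar>2 ^ m * \<phi> - of_int T\<bar> \<le> 1 / 3" for T z :: int
  proof -
    let ?\<eta> = "2 ^ m * \<phi> - real_of_int T"
    have wrong: "pmf ?p (\<not> odd z) \<le> (1 / 2) ^ (j + 1) \<and> pmf ?p (\<not> odd z) \<le> 1 / 4"
    proof (cases j)
      case 0
      \<comment> \<open>For the first bit, distance 1/3 is exactly where the angle reaches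
        pi/6.\<close>
      have "\<bar>pi * ?\<eta> / 2\<bar> = pi / 2 * \<bar>?\<eta>\<bar>"
        by (simp add: abs_mult)
      also have "\<dots> \<le> pi / 2 * (1 / 3)"
        using close 0 by (intro mult_left_mono) auto
      finally show ?thesis
        using sin_square_le_quarter[of "pi * ?\<eta> / 2"]
        unfolding pmf_trial_pmf_wrong[OF U ev norm j z] by (simp add: 0)
    next
      case (Suc i)
      \<comment> \<open>From the second bit on the angle is pi \<eta> / 4 halved \<open>i\<close>
        times; here pi/6 is reached at distance 2/3, which fixes the tolerance in
        \<open>tracks\<close>.\<close>
      have "\<bar>pi * ?\<eta> / 4\<bar> = pi / 4 * \<bar>?\<eta>\<bar>"
        by (simp add: abs_mult)
      also have "\<dots> \<le> pi / 4 * (2 / 3)"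
        using T by (intro mult_left_mono) auto
      finally have "(sin (pi * ?\<eta> / 4 / 2 ^ i))\<^sup>2 \<le> (1 / 2) ^ (i + 2)"
        by (intro sin_square_halving_le) simp
      moreover have "(1 / 2 :: real) ^ (i + 2) \<le> (1 / 2) ^ 2"
        by (intro power_decreasing) auto
      ultimately show ?thesis
        unfolding pmf_trial_pmf_wrong[OF U ev norm j z] by (simp add: Suc power2_eq_square)
    qed
    have "pmf ?q (\<not> odd z) \<le> ?e"
    proof (cases "j < L")
      case True
      then have "trials m L L (m - j) = L + 1"
        using j by (simp add: trials_def)
      then show ?thesis
        using True vote_pmf_error_le[OF conjunct2[OF wrong], of tie "L + 1"] by simp
    next
      case False
      then have "trials m L L (m - j) = 1"
        using j by (simp add: trials_def)
      then show ?thesis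
        using False wrong by (simp add: vote_pmf_1[simplified])
    qed
    moreover have "pmf ?q (odd z) = 1 - pmf ?q (\<not> odd z)"
      by (cases "odd z") (simp_all add: pmf_False_conv_True)
    moreover have "pmf ?q (odd z) \<le> measure (measure_pmf ?q) ((\<lambda>x. x # xs) -` {ys. tracks m \<phi> (Suc j) ys})"
      unfolding measure_pmf_single[symmetric]
      using tracks_Cons[OF len T z] by (intro measure_pmf.finite_measure_mono) auto
    ultimately show ?thesis by simp
  qed
  show ?thesis
  proof (cases "0 < j")
    case True
    then show ?thesis
      using xs single unfolding tracks_def by blast
  next
    case False
    then have [simp]: "j = 0" "xs = []"
      using len by auto
    define T where "T = round (2 ^ m * \<phi>)"
    have T: "\<bar>2 ^ m * \<phi> - of_int T\<bar> \<le> 1 / 2"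
      unfolding T_def using of_int_round_abs_le[of "2 ^ m * \<phi>"] by (simp add: abs_minus_commute)
    show ?thesis
    proof (cases "\<bar>2 ^ m * \<phi> - of_int T\<bar> \<le> 1 / 3")
      case True
      then show ?thesis
        by (intro single[of T T]) (auto simp: binary_fraction_Nil)
    next
      case False
      \<comment> \<open>The neighbour of \<open>T\<close> on the other side of 2^m \<phi>: as
        \<open>T\<close> is more than 1/3 away, \<open>T'\<close> is less than 2/3 away, and its
        parity is opposite.\<close>
      define T' where "T' = (if 2 ^ m * \<phi> < of_int T then T - 1 else T + 1)"
      have "\<bar>2 ^ m * \<phi> - of_int T'\<bar> \<le> 2 / 3"
        using T False by (auto simp: T'_def abs_if split: if_splits)
      then have "tracks m \<phi> (Suc j) (odd T' # xs)"
        by (intro tracks_Cons) (auto simp: binary_fraction_Nil)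
      moreover have "tracks m \<phi> (Suc j) (odd T # xs)"
        using T by (intro tracks_Cons) (auto simp: binary_fraction_Nil)
      moreover have "odd T' \<longleftrightarrow> \<not> odd T"
        by (simp add: T'_def)
      ultimately have "tracks m \<phi> (Suc j) (x # xs)" for x
        by (cases x; cases "odd T") auto
      then have "measure (measure_pmf ?q) ((\<lambda>x. x # xs) -` {ys. tracks m \<phi> (Suc j) ys}) = 1"
        by (simp add: vimage_def)
      moreover have "0 \<le> ?e" by simp
      ultimately show ?thesis
        unfolding measure_map_pmf by linarith
    qed
  qed
qed

section \<open>Success probability of the whole run, uniformly in the number of bits\<close>

text \<open>The first factor covers \<open>L\<close> repeated bits. The second bounds the infinite
  product of 1 - 2^-(j+1) over all j \<ge> L from below.\<close>

definition success_bound :: "nat \<Rightarrow> real" where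
  "success_bound L = (1 - (7 / 8) ^ (L + 1)) ^ L * (1 - (1 / 2) ^ L)"

lemma power_seven_eighths_less_1: "(7 / 8 :: real) ^ (L + 1) < 1"
  using power_Suc_less_one[of "7 / 8 :: real" L] by simp

text \<open>The repeated bits contribute equal factors. For the others, the errors 2^-(i+1) with L
  \<le> i < j add up to 2^-L - 2^-j, which the stated bound subtracts from 1.\<close>

lemma ipea_bits_tracks:
  assumes U: "U \<in> carrier_mat d d"
    and ev: "eigenvector U \<psi> (exp (2 * complex_of_real pi * \<i> * complex_of_real \<phi>))"
    and norm: "\<psi> \<bullet>c \<psi> = 1"
  defines "s \<equiv> \<lambda>L. (7 / 8 :: real) ^ (L + 1)"
  assumes "j \<le> m"
  shows "(if j \<le> L then (1 - s L) ^ j else (1 - s L) ^ L * (1 - (1 / 2) ^ L + (1 / 2) ^ j))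
    \<le> measure (measure_pmf (ipea_bits tie (trials m L L) U \<psi> m j)) {xs. tracks m \<phi> j xs}"
  using \<open>j \<le> m\<close>
proof (induction j)
  case 0
  have "tracks m \<phi> 0 []"
    unfolding tracks_def using of_int_round_abs_le[of "2 ^ m * \<phi>"]
    by (auto simp: binary_fraction_Nil abs_minus_commute intro!: exI[of _ "round (2 ^ m * \<phi>)"])
  then show ?case by simp
next
  case (Suc j)
  have s: "0 \<le> 1 - s L"
    using power_seven_eighths_less_1[of L] by (simp add: s_def)
  let ?B = "\<lambda>j. if j \<le> L then (1 - s L) ^ j else (1 - s L) ^ L * (1 - (1 / 2) ^ L + (1 / 2) ^ j)"
  let ?e = "if j < L then s L else (1 / 2) ^ (j + 1)"
  have e: "0 \<le> 1 - ?e"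
    using s power_le_one[of "1 / 2 :: real" "j + 1"] by auto
  have "?B (Suc j) \<le> ?B j * (1 - ?e)"
  proof (cases "j < L")
    case True
    then show ?thesis by simp
  next
    case False
    define u v :: real where "u = (1 / 2) ^ L" and "v = (1 / 2) ^ j"
    have "v \<le> u" "0 \<le> v"
      unfolding u_def v_def using False by (auto intro!: power_decreasing)
    \<comment> \<open>The two sides of the next inequality differ by v (u - v) / 2.\<close>
    then have "v * v \<le> v * u"
      by (intro mult_left_mono)
    then have "1 - u + v / 2 \<le> (1 - u + v) * (1 - v / 2)"
      by (simp add: field_simps)
    then have "(1 - s L) ^ L * (1 - u + v / 2) \<le> (1 - s L) ^ L * ((1 - u + v) * (1 - v / 2))"
      using s by (intro mult_left_mono) simp_all
    \<comment> \<open>For j = L both branches of \<open>?B\<close> agree, because then u =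
      v.\<close>
    moreover have "?B j = (1 - s L) ^ L * (1 - u + v)"
      using False by (auto simp: u_def v_def)
    ultimately show ?thesis
      using False by (simp add: u_def v_def mult.assoc)
  qed
  also have "\<dots> \<le> measure (measure_pmf (ipea_bits tie (trials m L L) U \<psi> m j)) {xs. tracks m \<phi> j xs} * (1 - ?e)"
    using Suc e by (intro mult_right_mono) auto
  also have "\<dots> \<le> measure (measure_pmf (ipea_bits tie (trials m L L) U \<psi> m (Suc j))) {xs. tracks m \<phi> (Suc j) xs}"
    unfolding ipea_bits.simps s_def
    by (intro measure_bind_pmf_ge vote_step[OF U ev norm]) (use Suc.prems in auto)
  finally show ?case .
qed

text \<open>Strictness comes from the run being finite: for m \<le> L the second factor of
  \<open>success_bound\<close> is not incurred, otherwise the summand 2^-m is left over.\<close>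

lemma ipea_error_less:
  assumes U: "U \<in> carrier_mat d d"
    and ev: "eigenvector U \<psi> (exp (2 * complex_of_real pi * \<i> * complex_of_real \<phi>))"
    and norm: "\<psi> \<bullet>c \<psi> = 1"
  shows "measure (measure_pmf (ipea tie (trials m L L) U \<psi> m))
    {xs. \<not> accurate m \<phi> (binary_fraction xs)} < 1 - success_bound L"
proof -
  let ?M = "measure_pmf (ipea tie (trials m L L) U \<psi> m)"
  let ?s = "(7 / 8 :: real) ^ (L + 1)"
  have s: "0 < 1 - ?s"
    using power_seven_eighths_less_1[of L] by simp
  have "success_bound L < (if m \<le> L then (1 - ?s) ^ m else (1 - ?s) ^ L * (1 - (1 / 2) ^ L + (1 / 2) ^ m))"
  proof (cases "m \<le> L")
    case True
    have "success_bound L < (1 - ?s) ^ L * 1"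
      unfolding success_bound_def using s by (intro mult_strict_left_mono zero_less_power) auto
    also have "\<dots> \<le> (1 - ?s) ^ m"
      using s True by (auto intro!: power_decreasing)
    finally show ?thesis using True by simp
  next
    case False
    then show ?thesis
      unfolding success_bound_def using s by (auto intro!: mult_strict_left_mono zero_less_power)
  qed
  also have "\<dots> \<le> measure ?M {xs. tracks m \<phi> m xs}"
    unfolding ipea_def by (intro ipea_bits_tracks[OF U ev norm]) simp
  also have "\<dots> \<le> measure ?M (- {xs. \<not> accurate m \<phi> (binary_fraction xs)})"
    using tracks_accurate by (intro measure_pmf.finite_measure_mono) auto
  also have "\<dots> = 1 - measure ?M {xs. \<not> accurate m \<phi> (binary_fraction xs)}"
    using measure_pmf.prob_compl[of "{xs. \<not> accurate m \<phi> (binary_fraction xs)}"]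
    by (simp add: Compl_eq_Diff_UNIV)
  finally show ?thesis by simp
qed

lemma success_bound_pos:
  assumes "0 < L"
  shows "0 < success_bound L"
proof -
  have "(1 / 2 :: real) ^ L < 1"
    using assms power_Suc_less_one[of "1 / 2 :: real" "L - 1"] by simp
  then show ?thesis
    unfolding success_bound_def using power_seven_eighths_less_1[of L]
    by (intro mult_pos_pos zero_less_power) simp_all
qed

text \<open>Bernoulli's inequality turns the product into a union bound, whose exponential decay
  settles large \<open>L\<close>.\<close>

lemma one_minus_success_bound_le:
  "1 - success_bound L \<le> real L * (7 / 8) ^ (L + 1) + (1 / 2) ^ L"
proof -
  define s u :: real where "s = (7 / 8) ^ (L + 1)" and "u = (1 / 2) ^ L"
  have s: "0 \<le> s" "s \<le> 1" and u: "0 \<le> u"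
    using power_seven_eighths_less_1[of L] by (simp_all add: s_def u_def)
  have "1 + real L * (- s) \<le> (1 + (- s)) ^ L"
    using s by (intro Bernoulli_inequality) auto
  moreover have "(1 - s) ^ L * u \<le> 1 * u"
    using s u by (intro mult_right_mono power_le_one) auto
  ultimately show ?thesis
    unfolding success_bound_def s_def[symmetric] u_def[symmetric] by (simp add: right_diff_distrib)
qed

section \<open>Choice of the base of the logarithm\<close>

text \<open>For large \<open>L\<close> the exponential decay beats the growth of b^L; the finitely
  many smaller \<open>L\<close> are handled by continuity at b = 1. For L = 0 equality holds for
  every \<open>b\<close>.\<close>

lemma success_bound_base:
  "\<exists>b\<^sub>0>1. \<forall>b. 1 < b \<and> b \<le> b\<^sub>0 \<longrightarrow> (\<forall>L. (1 - success_bound L) * b ^ L \<le> 1)"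
proof -
  \<comment> \<open>With b at most 16/15 the decay rates 7/8 and 1/2 become 14/15 and 8/15, still
    below 1.\<close>
  have "(\<lambda>L. 7 / 8 * (real L * (14 / 15) ^ L) + (8 / 15) ^ L) \<longlonglongrightarrow> 7 / 8 * 0 + 0"
    by (intro tendsto_intros powser_times_n_limit_0 LIMSEQ_power_zero) auto
  then have "eventually (\<lambda>L. 7 / 8 * (real L * (14 / 15) ^ L) + (8 / 15) ^ L < 1) sequentially"
    by (rule order_tendstoD) simp
  then obtain N where N: "\<And>L. N \<le> L \<Longrightarrow> 7 / 8 * (real L * (14 / 15) ^ L) + (8 / 15) ^ L < 1"
    by (auto simp: eventually_sequentially)
  have "eventually (\<lambda>b. (1 - success_bound L) * b ^ L \<le> 1) (at_right 1)" for L
  proof (cases "L = 0")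
    case True
    then show ?thesis by (simp add: success_bound_def)
  next
    case False
    have "((\<lambda>b. (1 - success_bound L) * b ^ L) \<longlongrightarrow> (1 - success_bound L) * 1 ^ L) (at_right 1)"
      by (intro tendsto_intros)
    then have "eventually (\<lambda>b. (1 - success_bound L) * b ^ L < 1) (at_right 1)"
      using success_bound_pos[of L] False by (intro order_tendstoD) auto
    then show ?thesis by (rule eventually_mono) simp
  qed
  then have "eventually (\<lambda>b. \<forall>L\<in>{..<N}. (1 - success_bound L) * b ^ L \<le> 1) (at_right 1)"
    by (simp add: eventually_ball_finite)
  then obtain b\<^sub>1 where b\<^sub>1: "1 < b\<^sub>1"
    "\<And>b L. 1 < b \<Longrightarrow> b < b\<^sub>1 \<Longrightarrow> L < N \<Longrightarrow> (1 - success_bound L) * b ^ L \<le> 1"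
    by (auto simp: eventually_at_right_field)
  \<comment> \<open>The midpoint of 1 and \<open>b\<^sub>1\<close> is used because the bound for
    small \<open>L\<close> needs \<open>b\<close> strictly below \<open>b\<^sub>1\<close>.\<close>
  have "(1 - success_bound L) * b ^ L \<le> 1" if b: "1 < b" "b \<le> min (16 / 15) ((1 + b\<^sub>1) / 2)" for b L
  proof (cases "L < N")
    case True
    then show ?thesis using b b\<^sub>1 by (intro b\<^sub>1(2)) auto
  next
    case False
    have "(1 - success_bound L) * b ^ L \<le> (real L * (7 / 8) ^ (L + 1) + (1 / 2) ^ L) * (16 / 15) ^ L"
      using b by (intro mult_mono one_minus_success_bound_le power_mono) auto
    also have "\<dots> = 7 / 8 * (real L * (7 / 8 * (16 / 15)) ^ L) + (1 / 2 * (16 / 15)) ^ L"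
      unfolding power_mult_distrib by (simp add: algebra_simps)
    also have "\<dots> \<le> 1"
      using N[of L] False by simp
    finally show ?thesis .
  qed
  then show ?thesis
    using b\<^sub>1(1) by (intro exI[of _ "min (16 / 15) ((1 + b\<^sub>1) / 2)"]) auto
qed

section \<open>Repetition, iteration and gate counts\<close>

lemma log_reps_ge:
  assumes "1 < b" "0 < \<epsilon>"
  shows "1 \<le> \<epsilon> * b ^ log_reps b \<epsilon>"
proof -
  have "log b (1 / \<epsilon>) \<le> real (log_reps b \<epsilon>)"
    by (simp add: log_reps_def real_nat_ceiling_ge)
  then have "1 / \<epsilon> \<le> b powr real (log_reps b \<epsilon>)"
    using assms by (simp add: log_le_iff)
  then show ?thesis
    using assms by (simp add: powr_realpow field_simps)
qed

lemma log_reps_le: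
  assumes "0 \<le> log b (1 / \<epsilon>)"
  shows "real (log_reps b \<epsilon>) \<le> log b (1 / \<epsilon>) + 1"
  using assms unfolding log_reps_def by linarith

lemma log_reps_square_le: "(real (log_reps b \<epsilon>))\<^sup>2 \<le> 2 * (log b (1 / \<epsilon>))\<^sup>2 + 2"
proof (cases "0 \<le> log b (1 / \<epsilon>)")
  case True
  then have "(real (log_reps b \<epsilon>))\<^sup>2 \<le> (log b (1 / \<epsilon>) + 1)\<^sup>2"
    by (intro power_mono log_reps_le) auto
  also have "\<dots> \<le> 2 * (log b (1 / \<epsilon>))\<^sup>2 + 2"
    using zero_le_power2[of "log b (1 / \<epsilon>) - 1"] by (simp add: power2_eq_square algebra_simps)
  finally show ?thesis .
next
  case False
  then have "log_reps b \<epsilon> = 0" by (simp add: log_reps_def)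
  then show ?thesis by simp
qed

text \<open>The weight \<open>f\<close> is 1 for iterations and 2^(k-1) for gates. The index t = m +
  1 - k counts bits from the least significant; at most \<open>m\<close> of them exist, hence the
  minimum.\<close>

lemma sum_trials:
  "(\<Sum>k=1..m. trials m L N k * f k) = (\<Sum>k=1..m. f k) + N * (\<Sum>t=1..min L m. f (m + 1 - t))"
proof -
  have "(\<Sum>k=1..m. trials m L N k * f k) = (\<Sum>k=1..m. f k + (if m < k + L then N * f k else 0))"
    by (intro sum.cong) (auto simp: trials_def)
  also have "\<dots> = (\<Sum>k=1..m. f k) + (\<Sum>k \<in> {k \<in> {1..m}. m < k + L}. N * f k)"
    by (simp add: sum.distrib flip: sum.inter_filter)
  also have "(\<Sum>k \<in> {k \<in> {1..m}. m < k + L}. N * f k) = (\<Sum>t=1..min L m. N * f (m + 1 - t))"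
    by (rule sum.reindex_bij_witness[of _ "\<lambda>t. m + 1 - t" "\<lambda>k. m + 1 - k"]) auto
  finally show ?thesis by (simp add: sum_distrib_left)
qed

lemma iteration_count_trials: "iteration_count m (trials m L L) \<le> m + L\<^sup>2"
  using sum_trials[of m L L "\<lambda>_. 1"] by (simp add: iteration_count_def power2_eq_square)

lemma gate_count_trials:
  "real (gate_count m (trials m L L)) =
    (\<Sum>k=1..m. 2 ^ (k - 1)) + real L * (\<Sum>t=1..min L m. 2 powi (int m - int t))"
proof -
  have "real (2 ^ (m + 1 - t - 1)) = 2 powi (int m - int t)" if "t \<le> m" for t
    using that by (simp add: power_int_def nat_diff_distrib)
  then have "(\<Sum>t=1..min L m. real (2 ^ (m + 1 - t - 1))) = (\<Sum>t=1..min L m. 2 powi (int m - int t))"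
    by (intro sum.cong) auto
  then show ?thesis
    unfolding gate_count_def sum_trials by simp
qed

text \<open>The inner geometric sum is 2^m - 2^(m-L), so it stays below 2^m even when L exceeds
  m.\<close>

lemma gate_formula_le: "gate_formula b \<epsilon> m \<le> 2 ^ m * (1 + real (log_reps b \<epsilon>))"
proof -
  have "(\<Sum>k=1..m. (2::real) ^ (k - 1)) = 2 ^ m - 1"
    by (induction m) auto
  moreover have "(\<Sum>t=1..L. (2::real) powi (int m - int t)) = 2 ^ m - 2 powi (int m - int L)" for L
    by (induction L) (auto simp: power_int_diff power_int_add)
  then have "(\<Sum>t=1..L. (2::real) powi (int m - int t)) \<le> 2 ^ m" for L
    by simp
  then have "real (log_reps b \<epsilon>) * (\<Sum>t=1..log_reps b \<epsilon>. 2 powi (int m - int t)) \<le> real (log_reps b \<epsilon>) * 2 ^ m"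
    by (intro mult_left_mono) auto
  ultimately show ?thesis
    unfolding gate_formula_def by (simp add: algebra_simps)
qed

section \<open>Bounds in terms of \<epsilon>\<close>

lemma ipea_error_less_epsilon:
  "\<exists>b\<^sub>0>1. \<forall>b. 1 < b \<and> b \<le> b\<^sub>0 \<longrightarrow>
     (\<forall>(\<epsilon>::real) (m::nat) (d::nat) (U::complex mat) (\<psi>::complex vec) (\<phi>::real) (tie::bool).
        0 < \<epsilon> \<longrightarrow> U \<in> carrier_mat d d \<longrightarrow>
        eigenvector U \<psi> (exp (2 * complex_of_real pi * \<i> * complex_of_real \<phi>)) \<longrightarrow>
        \<psi> \<bullet>c \<psi> = 1 \<longrightarrow>
        measure_pmf.prob (ipea tie (trials m (log_reps b \<epsilon>) (log_reps b \<epsilon>)) U \<psi> m)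
          {xs. \<not> accurate m \<phi> (binary_fraction xs)} < \<epsilon>)"
proof -
  obtain b\<^sub>0 where b\<^sub>0: "1 < b\<^sub>0"
    "\<And>b L. 1 < b \<Longrightarrow> b \<le> b\<^sub>0 \<Longrightarrow> (1 - success_bound L) * b ^ L \<le> 1"
    using success_bound_base by auto
  have "1 - success_bound (log_reps b \<epsilon>) \<le> \<epsilon>" if "1 < b" "b \<le> b\<^sub>0" "0 < \<epsilon>" for b \<epsilon>
  proof -
    have "(1 - success_bound (log_reps b \<epsilon>)) * b ^ log_reps b \<epsilon> \<le> \<epsilon> * b ^ log_reps b \<epsilon>"
      using b\<^sub>0(2) log_reps_ge that by (meson order_trans)
    then show ?thesis
      using that by (simp add: mult_le_cancel_right)
  qed
  then show ?thesis
    using b\<^sub>0(1) by (intro exI[of _ b\<^sub>0]) (auto intro: less_le_trans[OF ipea_error_less])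
qed

lemma iteration_count_le:
  assumes "1 \<le> m"
  shows "real (iteration_count m (trials m (log_reps b \<epsilon>) (log_reps b \<epsilon>)))
    \<le> 3 * (real m + (log b (1 / \<epsilon>))\<^sup>2)"
proof -
  have "real (iteration_count m (trials m (log_reps b \<epsilon>) (log_reps b \<epsilon>)))
      \<le> real (m + (log_reps b \<epsilon>)\<^sup>2)"
    using iteration_count_trials of_nat_le_iff by blast
  also have "\<dots> \<le> real m + (2 * (log b (1 / \<epsilon>))\<^sup>2 + 2)"
    using log_reps_square_le[of b \<epsilon>] by simp
  \<comment> \<open>The additive 2 is at most 2 m because m \<ge> 1.\<close>
  also have "\<dots> \<le> 3 * (real m + (log b (1 / \<epsilon>))\<^sup>2)"
  proof -
    have "1 \<le> real m" using assms by simp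
    then show ?thesis
      using zero_le_power2[of "log b (1 / \<epsilon>)"] unfolding distrib_left by linarith
  qed
  finally show ?thesis .
qed

text \<open>If more than \<open>m\<close> bits are requested, the formula has additional positive
  terms with t > m that correspond to no bit.\<close>

lemma gate_count_le_gate_formula:
  "real (gate_count m (trials m (log_reps b \<epsilon>) (log_reps b \<epsilon>))) \<le> gate_formula b \<epsilon> m"
  unfolding gate_count_trials gate_formula_def
  by (intro add_left_mono mult_left_mono sum_mono2) auto

lemma gate_count_eq_gate_formula:
  "log_reps b \<epsilon> \<le> m \<Longrightarrow>
    real (gate_count m (trials m (log_reps b \<epsilon>) (log_reps b \<epsilon>))) = gate_formula b \<epsilon> m"
  unfolding gate_count_trials gate_formula_def by (simp add: min_absorb1)

text \<open>Keeping \<epsilon> away from 1 bounds the logarithm below by c > 0. The additive 2, one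
  from the unrepeated sum and one from rounding up, is then at most 2/c times the logarithm.\<close>

lemma gate_formula_bigo:
  assumes b: "1 < b" and \<epsilon>\<^sub>0: "0 < \<epsilon>\<^sub>0" "\<epsilon>\<^sub>0 < 1"
  shows "\<exists>K>0. \<forall>(\<epsilon>::real) (m::nat). 0 < \<epsilon> \<longrightarrow> \<epsilon> \<le> \<epsilon>\<^sub>0 \<longrightarrow>
    gate_formula b \<epsilon> m \<le> K * (2 ^ m * log b (1 / \<epsilon>))"
proof -
  define c where "c = log b (1 / \<epsilon>\<^sub>0)"
  have c: "0 < c"
    using assms by (simp add: c_def zero_less_log_cancel_iff)
  have "gate_formula b \<epsilon> m \<le> (2 / c + 1) * (2 ^ m * log b (1 / \<epsilon>))" if \<epsilon>: "0 < \<epsilon>" "\<epsilon> \<le> \<epsilon>\<^sub>0" for \<epsilon> m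
  proof -
    have l: "c \<le> log b (1 / \<epsilon>)"
      unfolding c_def using assms \<epsilon> by (simp add: log_le_cancel_iff frac_le)
    then have "2 \<le> 2 / c * log b (1 / \<epsilon>)"
      using c by (simp add: field_simps)
    moreover have "real (log_reps b \<epsilon>) \<le> log b (1 / \<epsilon>) + 1"
      using l c by (intro log_reps_le) simp
    ultimately have "1 + real (log_reps b \<epsilon>) \<le> (2 / c + 1) * log b (1 / \<epsilon>)"
      by (simp add: algebra_simps)
    then have "2 ^ m * (1 + real (log_reps b \<epsilon>)) \<le> 2 ^ m * ((2 / c + 1) * log b (1 / \<epsilon>))"
      by (rule mult_left_mono) simp
    also have "\<dots> = (2 / c + 1) * (2 ^ m * log b (1 / \<epsilon>))"
      by (rule mult.left_commute)
    finally show ?thesis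
      using gate_formula_le[of b \<epsilon> m] by (rule order_trans[rotated])
  qed
  moreover have "0 < 2 / c + 1"
    using c by (simp add: add_pos_pos)
  ultimately show ?thesis by blast
qed

theorem mainTheorem2:
  shows
    "(\<exists>b\<^sub>0>1. \<forall>b. 1 < b \<and> b \<le> b\<^sub>0 \<longrightarrow>
       (\<forall>(\<epsilon>::real) (m::nat) (d::nat) (U::complex mat) (\<psi>::complex vec) (\<phi>::real) (tie::bool).
          0 < \<epsilon> \<longrightarrow> 1 \<le> m \<longrightarrow>
          U \<in> carrier_mat d d \<longrightarrow> unitary_mat U \<longrightarrow>
          eigenvector U \<psi> (exp (2 * complex_of_real pi * \<i> * complex_of_real \<phi>)) \<longrightarrow>
          \<psi> \<bullet>c \<psi> = 1 \<longrightarrow> 0 \<le> \<phi> \<longrightarrow> \<phi> < 1 \<longrightarrow>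
          measure_pmf.prob (ipea tie (trials m (log_reps b \<epsilon>) (log_reps b \<epsilon>)) U \<psi> m)
            {xs. \<not> accurate m \<phi> (binary_fraction xs)} < \<epsilon>))
     \<and> (\<forall>b>1.
          (\<exists>K>0. \<forall>(\<epsilon>::real) (m::nat). 0 < \<epsilon> \<longrightarrow> 1 \<le> m \<longrightarrow>
             real (iteration_count m (trials m (log_reps b \<epsilon>) (log_reps b \<epsilon>)))
               \<le> K * (real m + (log b (1 / \<epsilon>))\<^sup>2))
        \<and> (\<forall>(\<epsilon>::real) (m::nat). 0 < \<epsilon> \<longrightarrow> 1 \<le> m \<longrightarrow>
             real (gate_count m (trials m (log_reps b \<epsilon>) (log_reps b \<epsilon>))) \<le> gate_formula b \<epsilon> m
           \<and> (log_reps b \<epsilon> \<le> m \<longrightarrow>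
                real (gate_count m (trials m (log_reps b \<epsilon>) (log_reps b \<epsilon>))) = gate_formula b \<epsilon> m))
        \<and> (\<forall>\<epsilon>\<^sub>0. 0 < \<epsilon>\<^sub>0 \<and> \<epsilon>\<^sub>0 < 1 \<longrightarrow>
             (\<exists>K>0. \<forall>(\<epsilon>::real) (m::nat). 0 < \<epsilon> \<longrightarrow> \<epsilon> \<le> \<epsilon>\<^sub>0 \<longrightarrow> 1 \<le> m \<longrightarrow>
                gate_formula b \<epsilon> m \<le> K * (2 ^ m * log b (1 / \<epsilon>)))))"
proof (intro conjI allI impI)
  show "\<exists>b\<^sub>0>1. \<forall>b. 1 < b \<and> b \<le> b\<^sub>0 \<longrightarrow>
       (\<forall>(\<epsilon>::real) (m::nat) (d::nat) (U::complex mat) (\<psi>::complex vec) (\<phi>::real) (tie::bool).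
          0 < \<epsilon> \<longrightarrow> 1 \<le> m \<longrightarrow>
          U \<in> carrier_mat d d \<longrightarrow> unitary_mat U \<longrightarrow>
          eigenvector U \<psi> (exp (2 * complex_of_real pi * \<i> * complex_of_real \<phi>)) \<longrightarrow>
          \<psi> \<bullet>c \<psi> = 1 \<longrightarrow> 0 \<le> \<phi> \<longrightarrow> \<phi> < 1 \<longrightarrow>
          measure_pmf.prob (ipea tie (trials m (log_reps b \<epsilon>) (log_reps b \<epsilon>)) U \<psi> m)
            {xs. \<not> accurate m \<phi> (binary_fraction xs)} < \<epsilon>)"
    using ipea_error_less_epsilon by (elim exE conjE) (intro exI conjI, assumption, blast)
next
  fix b :: real assume "1 < b"
  show "\<exists>K>0. \<forall>(\<epsilon>::real) (m::nat). 0 < \<epsilon> \<longrightarrow> 1 \<le> m \<longrightarrow>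
      real (iteration_count m (trials m (log_reps b \<epsilon>) (log_reps b \<epsilon>)))
        \<le> K * (real m + (log b (1 / \<epsilon>))\<^sup>2)"
    by (intro exI[of _ 3] conjI allI impI iteration_count_le) simp
next
  fix b \<epsilon> :: real and m :: nat
  show "real (gate_count m (trials m (log_reps b \<epsilon>) (log_reps b \<epsilon>))) \<le> gate_formula b \<epsilon> m"
    by (rule gate_count_le_gate_formula)
next
  fix b \<epsilon> :: real and m :: nat
  assume "log_reps b \<epsilon> \<le> m"
  then show "real (gate_count m (trials m (log_reps b \<epsilon>) (log_reps b \<epsilon>))) = gate_formula b \<epsilon> m"
    by (rule gate_count_eq_gate_formula)
next
  fix b \<epsilon>\<^sub>0 :: real
  assume "1 < b" "0 < \<epsilon>\<^sub>0 \<and> \<epsilon>\<^sub>0 < 1"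
  then show "\<exists>K>0. \<forall>(\<epsilon>::real) (m::nat). 0 < \<epsilon> \<longrightarrow> \<epsilon> \<le> \<epsilon>\<^sub>0 \<longrightarrow> 1 \<le> m \<longrightarrow>
      gate_formula b \<epsilon> m \<le> K * (2 ^ m * log b (1 / \<epsilon>))"
    using gate_formula_bigo[of b \<epsilon>\<^sub>0] by blast
qed

end
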